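(* Consider the Riccati quadratic polynomial differential system in $\mathbb{R}^2$ $$\dot{x}=\alpha_2(x),\qquad \dot{y}=k y^2+\beta_1(x)\,y+\gamma_2(x),$$ where $(x,y)\in\mathbb{R}^2$, $k\neq 0$, $\gamma_2(x)$ is non-zero, $\beta_1(x)$ is a polynomial of degree at most $1$, $\alpha_2(x)$ and $\gamma_2(x)$ are polynomials of degree at most $2$, and the maximum of the degrees of $\alpha_2(x)$ and $ky^2+\beta_1(x)y+\gamma_2(x)$ is $2$. Then this system is topologically equivalent to one of the following systems: \begin{itemize} \item[(i)] $\dot{x}=x(x+1),\quad \dot{y}=y^2+(ax+b)y+cx^2+dx+e$; \item[(ii)] $\dot{x}=x^2,\quad \dot{y}=y^2+(ax+b)y+cx^2+dx+e$; \item[(iii)] $\dot{x}=x,\quad \dot{y}=y^2+(ax+b)y+cx^2+dx+e$; \item[(iv)] $\dot{x}=1,\quad \dot{y}=y^2+(ax+b)y+cx^2+dx+e$; \item[(v)] $\dot{x}=x^2+1,\quad \dot{y}=y^2+(ax+b)y+cx^2+dx+e$, \end{itemize} with $c^2+d^2+e^2\neq 0$ in all these systems.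
   Context: The dot denotes the derivative with respect to time $t$. All polynomials have real coefficients, and $k,a,b,c,d,e$ are real numbers. "$\gamma_2(x)$ non-zero" means that $\gamma_2$ is not the zero polynomial (otherwise the system is a Bernoulli differential system). Two planar differential systems are topologically equivalent if there is a homeomorphism of the plane that maps orbits of one system onto orbits of the other, either preserving the time orientation of all orbits or reversing the time orientation of all orbits.
   Formalization: The polynomial α₂(x) is additionally assumed not to be the zero polynomial; otherwise x' = 0, y' = y² − 1 is a counterexample, having infinitely many equilibria while systems (i)–(v) have finitely many. *)

theory Defs
  imports "HOL-Analysis.Analysis" "HOL-Computational_Algebra.Polynomial"
begin

type_synonym vector_field = "real \<times> real \<Rightarrow> real \<times> real"

definition solution_on :: "vector_field \<Rightarrow> real set \<Rightarrow> (real \<Rightarrow> real \<times> real) \<Rightarrow> bool" where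
  "solution_on F I \<phi> \<longleftrightarrow>
     open I \<and> is_interval I \<and> I \<noteq> {} \<and>
     (\<forall>t\<in>I. (\<phi> has_vector_derivative F (\<phi> t)) (at t))"

text \<open>Solutions may blow up in finite time, so orbits are images of maximal
  solutions rather than of a global flow.\<close>

definition maximal_solution_on :: "vector_field \<Rightarrow> real set \<Rightarrow> (real \<Rightarrow> real \<times> real) \<Rightarrow> bool" where
  "maximal_solution_on F I \<phi> \<longleftrightarrow>
     solution_on F I \<phi> \<and>
     (\<forall>J \<psi>. solution_on F J \<psi> \<and> I \<subseteq> J \<and> (\<forall>t\<in>I. \<psi> t = \<phi> t) \<longrightarrow> J = I)"

definition orbits :: "vector_field \<Rightarrow> (real \<times> real) set set" where
  "orbits F = {\<phi> ` I |I \<phi>. maximal_solution_on F I \<phi>}"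

text \<open>A strictly monotone map of one interval onto another is automatically a
  homeomorphism, so \<open>\<tau>\<close> below is an orientation preserving (respectively reversing)
  reparametrisation of time. It exists for all orbits, including equilibria and
  periodic orbits.\<close>

definition preserves_time_orientation ::
    "vector_field \<Rightarrow> vector_field \<Rightarrow> (real \<times> real \<Rightarrow> real \<times> real) \<Rightarrow> bool" where
  "preserves_time_orientation F G h \<longleftrightarrow>
     (\<forall>I \<phi>. maximal_solution_on F I \<phi> \<longrightarrow>
       (\<exists>J \<psi> \<tau>. maximal_solution_on G J \<psi> \<and> \<tau> ` I = J \<and> strict_mono_on I \<tau> \<and>
          (\<forall>t\<in>I. h (\<phi> t) = \<psi> (\<tau> t))))"

definition reverses_time_orientation ::
    "vector_field \<Rightarrow> vector_field \<Rightarrow> (real \<times> real \<Rightarrow> real \<times> real) \<Rightarrow> bool" where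
  "reverses_time_orientation F G h \<longleftrightarrow>
     (\<forall>I \<phi>. maximal_solution_on F I \<phi> \<longrightarrow>
       (\<exists>J \<psi> \<tau>. maximal_solution_on G J \<psi> \<and> \<tau> ` I = J \<and> strict_antimono_on I \<tau> \<and>
          (\<forall>t\<in>I. h (\<phi> t) = \<psi> (\<tau> t))))"

definition topologically_equivalent :: "vector_field \<Rightarrow> vector_field \<Rightarrow> bool" where
  "topologically_equivalent F G \<longleftrightarrow>
     (\<exists>h h'. homeomorphism UNIV UNIV h h' \<and>
        (\<lambda>S. h ` S) ` orbits F = orbits G \<and>
        (preserves_time_orientation F G h \<or> reverses_time_orientation F G h))"

text \<open>Elements of \<open>real poly poly\<close> are read as polynomials in \<open>y\<close> with
  coefficients in \<open>\<real>[x]\<close>. The zero polynomial gets total degree 0, as it does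
  for \<open>degree\<close>.\<close>

definition total_degree :: "real poly poly \<Rightarrow> nat" where
  "total_degree p = Max (insert 0 {i + degree (coeff p i) |i. coeff p i \<noteq> 0})"

definition riccati_poly :: "real \<Rightarrow> real poly \<Rightarrow> real poly \<Rightarrow> real poly poly" where
  "riccati_poly k \<beta> \<gamma> = [:\<gamma>, \<beta>, [:k:]:]"

definition riccati_field :: "real poly \<Rightarrow> real \<Rightarrow> real poly \<Rightarrow> real poly \<Rightarrow> vector_field" where
  "riccati_field \<alpha> k \<beta> \<gamma> = (\<lambda>(x, y). (poly \<alpha> x, k * y\<^sup>2 + poly \<beta> x * y + poly \<gamma> x))"

lemma poly_riccati_poly:
  "poly (poly (riccati_poly k \<beta> \<gamma>) [:y:]) x = k * y\<^sup>2 + poly \<beta> x * y + poly \<gamma> x"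
  by (simp add: riccati_poly_def algebra_simps power2_eq_square)

text \<open>A Riccati system comes from a Riccati equation
  \<open>dy/dx = (k y^2 + \<beta>(x) y + \<gamma>(x)) / \<alpha>(x)\<close>, so \<open>\<alpha>\<close> is not the zero polynomial.
  For \<open>\<alpha> = 0\<close> the classification fails: \<open>x' = 0, y' = y^2 - 1\<close> has the two lines
  \<open>y = 1\<close> and \<open>y = -1\<close> of equilibria, while a system
  \<open>x' = p(x), y' = y^2 + (a x + b) y + c x^2 + d x + e\<close> with \<open>p\<close> a nonzero polynomial has only
  finitely many. Statements about \<open>riccati_field\<close> therefore assume \<open>\<alpha> \<noteq> 0\<close>.\<close>

end

theory Submission
  imports Defs
begin

text \<open>An affine change of coordinates \<open>x = p X + q\<close>, \<open>y = r Y\<close> together with a rescaling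
  \<open>t = s T\<close> of time (orientation reversing if \<open>s < 0\<close>) is a topological equivalence. It turns
  \<open>\<alpha>(x)\<close> into \<open>(s / p) \<alpha>(p X + q)\<close> and the coefficient \<open>k\<close> into \<open>s k r\<close>. The root structure of
  \<open>\<alpha>\<close> determines \<open>p\<close>, \<open>q\<close> and \<open>s\<close>, and \<open>r = 1 / (s k)\<close>.\<close>

text \<open>The derivative of \<open>h\<close> sends \<open>F\<close> to \<open>c\<close> times
  \<open>G\<close>. Traversing the image curve at speed \<open>1 / c\<close> cancels this factor by
  the chain rule. A negative \<open>c\<close> runs time backwards.\<close>

lemma solution_on_conjugate:
  fixes c :: real
  assumes sol: "solution_on F I \<phi>" and c: "c \<noteq> 0"
    and h: "\<And>z. (h has_derivative D z) (at z)"
    and G: "\<And>z. D z (F z) = c *\<^sub>R G (h z)"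
  shows "solution_on G ((*) c ` I) (\<lambda>t. h (\<phi> (t / c)))"
proof -
  have "open ((*) c ` I)" "is_interval ((*) c ` I)"
    using sol c open_scaling[of c I] convex_scaling[of I c]
    by (auto simp: solution_on_def is_interval_convex_1)
  moreover have "((\<lambda>t. h (\<phi> (t / c))) has_vector_derivative G (h (\<phi> (t / c)))) (at t)"
    if "t \<in> (*) c ` I" for t
  proof -
    have "(\<phi> has_vector_derivative F (\<phi> (t / c))) (at (t / c))"
      using sol c that by (auto simp: solution_on_def)
    moreover have "((\<lambda>t. t / c) has_vector_derivative 1 / c) (at t)"
      using c by (auto intro!: derivative_eq_intros simp flip: has_real_derivative_iff_has_vector_derivative)
    ultimately have "(\<phi> \<circ> (\<lambda>t. t / c) has_vector_derivative (1 / c) *\<^sub>R F (\<phi> (t / c))) (at t)"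
      by (intro vector_diff_chain_at)
    \<comment> \<open>The derivative of \<open>h\<close> is restricted to the image of the curve, as
      the chain rule applied next expects.\<close>
    moreover have "(h has_derivative D (\<phi> (t / c)))
        (at ((\<phi> \<circ> (\<lambda>t. t / c)) t) within (\<phi> \<circ> (\<lambda>t. t / c)) ` UNIV)"
      using h by (simp add: has_derivative_at_withinI)
    ultimately have "(h \<circ> (\<phi> \<circ> (\<lambda>t. t / c)) has_vector_derivative
        D (\<phi> (t / c)) ((1 / c) *\<^sub>R F (\<phi> (t / c)))) (at t)"
      by (rule vector_derivative_diff_chain_within)
    \<comment> \<open>Linearity of the derivative pulls out \<open>1 / c\<close>, which cancels the
      \<open>c\<close> in \<open>G\<close>.\<close>
    moreover have "D (\<phi> (t / c)) ((1 / c) *\<^sub>R F (\<phi> (t / c))) = G (h (\<phi> (t / c)))"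
      using G[of "\<phi> (t / c)"] c linear_cmul[OF has_derivative_linear[OF h]] by simp
    ultimately show ?thesis by (simp add: o_def)
  qed
  ultimately show ?thesis
    using sol by (auto simp: solution_on_def)
qed

text \<open>Any extension of the transported solution can be carried back by \<open>h'\<close> with
  time factor \<open>1 / c\<close>. The result extends \<open>\<phi>\<close>, so maximality of
  \<open>\<phi>\<close> fixes the interval.\<close>

lemma maximal_solution_on_conjugate:
  fixes c :: real
  assumes sol: "maximal_solution_on F I \<phi>" and c: "c \<noteq> 0"
    and h: "\<And>z. (h has_derivative D z) (at z)"
    and G: "\<And>z. D z (F z) = c *\<^sub>R G (h z)"
    and h': "\<And>z. (h' has_derivative D' z) (at z)"
    and F: "\<And>z. D' z (G z) = (1 / c) *\<^sub>R F (h' z)"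
    and inv: "\<And>z. h' (h z) = z"
  shows "maximal_solution_on G ((*) c ` I) (\<lambda>t. h (\<phi> (t / c)))"
  unfolding maximal_solution_on_def
proof (intro conjI allI impI)
  show "solution_on G ((*) c ` I) (\<lambda>t. h (\<phi> (t / c)))"
    using sol solution_on_conjugate[OF _ c h G] by (auto simp: maximal_solution_on_def)
next
  fix J \<psi>
  assume J: "solution_on G J \<psi> \<and> (*) c ` I \<subseteq> J \<and> (\<forall>t\<in>(*) c ` I. \<psi> t = h (\<phi> (t / c)))"
  let ?J = "(*) (1 / c) ` J"
  have "solution_on F ?J (\<lambda>t. h' (\<psi> (t / (1 / c))))"
    using J c by (intro solution_on_conjugate[OF _ _ h' F]) auto
  moreover have "I \<subseteq> ?J"
  proof
    fix t assume "t \<in> I"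
    then have "c * t \<in> J" using J by auto
    then show "t \<in> ?J" using c by (intro image_eqI[of _ _ "c * t"]) auto
  qed
  moreover have "\<forall>t\<in>I. h' (\<psi> (t / (1 / c))) = \<phi> t"
    using J c by (auto simp: inv mult.commute)
  ultimately have "?J = I"
    using sol unfolding maximal_solution_on_def by blast
  then have "(*) c ` I = (*) c ` ?J" by simp
  also have "\<dots> = J" using c by (simp add: image_image)
  finally show "J = (*) c ` I" by simp
qed

text \<open>Time is scaled by the same \<open>c\<close> on every orbit, so the sign of
  \<open>c\<close> decides between preserving and reversing orientation.\<close>

lemma topologically_equivalent_conjugate:
  fixes c :: real
  assumes c: "c \<noteq> 0"
    and h: "\<And>z. (h has_derivative D z) (at z)"
    and G: "\<And>z. D z (F z) = c *\<^sub>R G (h z)"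
    and h': "\<And>z. (h' has_derivative D' z) (at z)"
    and F: "\<And>z. D' z (G z) = (1 / c) *\<^sub>R F (h' z)"
    and inv: "\<And>z. h' (h z) = z" "\<And>z. h (h' z) = z"
  shows "topologically_equivalent F G"
proof -
  have fwd: "maximal_solution_on G ((*) c ` I) (\<lambda>t. h (\<phi> (t / c)))"
    if "maximal_solution_on F I \<phi>" for I \<phi>
    using maximal_solution_on_conjugate[OF that c h G h' F inv(1)] .
  \<comment> \<open>The hypotheses are symmetric under exchanging \<open>F\<close>,
    \<open>h\<close>, \<open>c\<close> with \<open>G\<close>, \<open>h'\<close>,
    \<open>1 / c\<close>.\<close>
  have bwd: "maximal_solution_on F ((*) (1 / c) ` I) (\<lambda>t. h' (\<phi> (t / (1 / c))))"
    if "maximal_solution_on G I \<phi>" for I \<phi>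
    using maximal_solution_on_conjugate[OF that _ h' F h _ inv(2)] c G by simp
  have "continuous_on UNIV h" "continuous_on UNIV h'"
    by (meson h h' continuous_at_imp_continuous_on has_derivative_continuous)+
  then have "homeomorphism UNIV UNIV h h'"
    using inv by (intro homeomorphismI) auto
  moreover have "(\<lambda>S. h ` S) ` orbits F = orbits G"
  proof (intro equalityI subsetI)
    fix S assume "S \<in> (\<lambda>S. h ` S) ` orbits F"
    then obtain I \<phi> where S: "maximal_solution_on F I \<phi>" "S = h ` \<phi> ` I"
      by (auto simp: orbits_def)
    have "S = (\<lambda>t. h (\<phi> (t / c))) ` (*) c ` I"
      using S c by (simp add: image_image)
    with fwd[OF S(1)] show "S \<in> orbits G" unfolding orbits_def by blast
  next
    fix S assume "S \<in> orbits G"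
    then obtain I \<phi> where S: "maximal_solution_on G I \<phi>" "S = \<phi> ` I"
      by (auto simp: orbits_def)
    \<comment> \<open>Every orbit of \<open>G\<close> is hit: it is the \<open>h\<close>-image of
      its own pullback.\<close>
    have "S = h ` (\<lambda>t. h' (\<phi> (t / (1 / c)))) ` (*) (1 / c) ` I"
      using S c by (simp add: image_image inv)
    with bwd[OF S(1)] show "S \<in> (\<lambda>S. h ` S) ` orbits F" unfolding orbits_def by blast
  qed
  moreover have "preserves_time_orientation F G h" if "c > 0"
    unfolding preserves_time_orientation_def
  proof (intro allI impI)
    fix I \<phi> assume "maximal_solution_on F I \<phi>"
    from fwd[OF this] that show "\<exists>J \<psi> \<tau>. maximal_solution_on G J \<psi> \<and> \<tau> ` I = J \<and>
        strict_mono_on I \<tau> \<and> (\<forall>t\<in>I. h (\<phi> t) = \<psi> (\<tau> t))"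
      by (intro exI[of _ "(*) c ` I"] exI[of _ "\<lambda>t. h (\<phi> (t / c))"] exI[of _ "(*) c"])
        (auto simp: monotone_on_def)
  qed
  moreover have "reverses_time_orientation F G h" if "c < 0"
    unfolding reverses_time_orientation_def
  proof (intro allI impI)
    fix I \<phi> assume "maximal_solution_on F I \<phi>"
    from fwd[OF this] that show "\<exists>J \<psi> \<tau>. maximal_solution_on G J \<psi> \<and> \<tau> ` I = J \<and>
        strict_antimono_on I \<tau> \<and> (\<forall>t\<in>I. h (\<phi> t) = \<psi> (\<tau> t))"
      by (intro exI[of _ "(*) c ` I"] exI[of _ "\<lambda>t. h (\<phi> (t / c))"] exI[of _ "(*) c"])
        (auto simp: monotone_on_def)
  qed
  ultimately show ?thesis
    using c unfolding topologically_equivalent_def by (metis linorder_neqE_linordered_idom)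
qed

text \<open>With \<open>x = p X + q\<close>, \<open>y = r Y\<close>, \<open>t = s T\<close>, the
  equation for \<open>Y\<close> is that for \<open>y\<close> multiplied by \<open>s / r\<close>, and
  \<open>y\<^sup>2\<close> contributes a further \<open>r\<^sup>2\<close>.\<close>

lemma riccati_field_affine_equivalent:
  fixes p q r s k :: real
  assumes "p \<noteq> 0" "r \<noteq> 0" "s \<noteq> 0"
  shows "topologically_equivalent (riccati_field \<alpha> k \<beta> \<gamma>)
    (\<lambda>(x, y). (s / p * poly \<alpha> (p * x + q),
       s * k * r * y\<^sup>2 + s * poly \<beta> (p * x + q) * y + s / r * poly \<gamma> (p * x + q)))"
\<comment> \<open>\<open>h\<close> leads from old to new coordinates, so it inverts the
  substitution; likewise the new time is \<open>t / s\<close>.\<close>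
proof (rule topologically_equivalent_conjugate[where c = "1 / s"
      and h = "\<lambda>z. ((fst z - q) / p, snd z / r)" and D = "\<lambda>_ v. (fst v / p, snd v / r)"
      and h' = "\<lambda>z. (p * fst z + q, r * snd z)" and D' = "\<lambda>_ v. (p * fst v, r * snd v)"])
qed (use assms in \<open>auto intro!: derivative_eq_intros
       simp: riccati_field_def divide_simps power2_eq_square algebra_simps\<close>)

lemma poly_degree_le_2:
  fixes f :: "'a :: comm_semiring_1 poly"
  assumes "degree f \<le> 2"
  shows "poly f x = coeff f 2 * x\<^sup>2 + coeff f 1 * x + coeff f 0"
proof -
  have "poly f x = (\<Sum>i\<le>2. coeff f i * x ^ i)"
    using arg_cong[OF poly_as_sum_of_monoms'[OF assms], of "\<lambda>g. poly g x"]
    by (simp add: poly_sum poly_monom)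
  then show ?thesis
    by (simp add: numeral_2_eq_2 algebra_simps)
qed

text \<open>Keeping \<open>A\<close> arbitrary lets one argument serve all five targets: only
  \<open>p\<close>, \<open>q\<close>, \<open>s\<close> depend on the case.\<close>

lemma riccati_field_equivalent_normal_form:
  fixes p q s k :: real
  assumes "p \<noteq> 0" "s \<noteq> 0" "k \<noteq> 0" "\<gamma> \<noteq> 0" "degree \<beta> \<le> 1" "degree \<gamma> \<le> 2"
    and A: "\<And>x. A x = s / p * poly \<alpha> (p * x + q)"
  shows "\<exists>a b c d e :: real. c\<^sup>2 + d\<^sup>2 + e\<^sup>2 \<noteq> 0 \<and>
    topologically_equivalent (riccati_field \<alpha> k \<beta> \<gamma>)
      (\<lambda>(x, y). (A x, y\<^sup>2 + (a * x + b) * y + c * x\<^sup>2 + d * x + e))"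
proof -
  \<comment> \<open>This scaling of \<open>y\<close> makes the new coefficient
    \<open>s * k * r\<close> of \<open>y\<^sup>2\<close> equal to 1.\<close>
  define r where "r = 1 / (s * k)"
  define B where "B = smult s (\<beta> \<circ>\<^sub>p [:q, p:])"
  define C where "C = smult (s / r) (\<gamma> \<circ>\<^sub>p [:q, p:])"
  have r: "r \<noteq> 0" "s * k * r = 1" using assms by (auto simp: r_def)
  have deg: "degree B \<le> 1" "degree C \<le> 2"
    using assms r by (auto simp: B_def C_def degree_pcompose)
  have B: "s * poly \<beta> (p * x + q) = coeff B 1 * x + coeff B 0" for x
  proof -
    have "poly B x = coeff B 1 * x + coeff B 0"
      using deg poly_degree_le_2[of B x] coeff_eq_0[of B 2] by simp
    then show ?thesis by (simp add: B_def poly_pcompose algebra_simps)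
  qed
  have C: "s / r * poly \<gamma> (p * x + q) = coeff C 2 * x\<^sup>2 + coeff C 1 * x + coeff C 0" for x
    using poly_degree_le_2[OF deg(2), of x] by (simp add: C_def poly_pcompose algebra_simps)
  \<comment> \<open>Composing with the nonconstant \<open>[:q, p:]\<close> cannot annihilate
    \<open>\<gamma>\<close>.\<close>
  have "C \<noteq> 0"
    using assms r by (simp add: C_def pcompose_eq_0_iff)
  then have "coeff C 2 \<noteq> 0 \<or> coeff C 1 \<noteq> 0 \<or> coeff C 0 \<noteq> 0"
    using poly_degree_le_2[OF deg(2)] by (auto simp flip: poly_all_0_iff_0)
  then have "(coeff C 2)\<^sup>2 + (coeff C 1)\<^sup>2 + (coeff C 0)\<^sup>2 \<noteq> 0"
    by (simp add: add_nonneg_eq_0_iff)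
  moreover have "topologically_equivalent (riccati_field \<alpha> k \<beta> \<gamma>)
      (\<lambda>(x, y). (A x, y\<^sup>2 + (coeff B 1 * x + coeff B 0) * y
        + coeff C 2 * x\<^sup>2 + coeff C 1 * x + coeff C 0))"
    using riccati_field_affine_equivalent[OF assms(1) r(1) assms(2), of \<alpha> k \<beta> \<gamma> q]
    unfolding A B C r(2) by (simp add: add.assoc)
  ultimately show ?thesis by blast
qed

lemma real_quadratic_cases:
  fixes u v w :: real
  assumes "u \<noteq> 0"
  obtains (distinct) m n where "m \<noteq> n" "\<And>x. u * x\<^sup>2 + v * x + w = u * (x - m) * (x - n)"
  | (double) m where "\<And>x. u * x\<^sup>2 + v * x + w = u * (x - m)\<^sup>2"
  | (complex) m n where "n \<noteq> 0" "\<And>x. u * x\<^sup>2 + v * x + w = u * ((x - m)\<^sup>2 + n\<^sup>2)"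
proof -
  \<comment> \<open>Completing the square: \<open>m\<close> is the vertex, and \<open>D\<close> is
    the discriminant divided by \<open>- 4 * u\<^sup>2\<close>, so \<open>D < 0\<close> means two
    real roots.\<close>
  define m where "m = - v / (2 * u)"
  define D where "D = w / u - m\<^sup>2"
  have v: "v = - 2 * u * m" using assms by (simp add: m_def)
  have w: "w = u * (D + m\<^sup>2)" using assms by (simp add: D_def)
  have sq: "u * x\<^sup>2 + v * x + w = u * ((x - m)\<^sup>2 + D)" for x
    unfolding v w by (simp add: power2_eq_square algebra_simps)
  consider "D = 0" | "D > 0" | "D < 0" by linarith
  then show thesis
  proof cases
    case 1
    then show thesis using double[of m] sq by simp
  next
    case 2
    then show thesis using complex[of "sqrt D" m] sq by simp
  next
    case 3
    define n where "n = sqrt (- D)"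
    have "D = - n\<^sup>2" "n \<noteq> 0" using 3 by (auto simp: n_def)
    then show thesis
      using distinct[of "m - n" "m + n"] sq by (simp add: power2_eq_square algebra_simps)
  qed
qed

theorem proposition1:
  fixes \<alpha> \<beta> \<gamma> :: "real poly" and k :: real
  assumes "\<alpha> \<noteq> 0"
    and "k \<noteq> 0"
    and "\<gamma> \<noteq> 0"
    and "degree \<beta> \<le> 1"
    and "degree \<alpha> \<le> 2"
    and "degree \<gamma> \<le> 2"
    and "max (degree \<alpha>) (total_degree (riccati_poly k \<beta> \<gamma>)) = 2"
  shows "\<exists>a b c d e :: real. c\<^sup>2 + d\<^sup>2 + e\<^sup>2 \<noteq> 0 \<and>
    (topologically_equivalent (riccati_field \<alpha> k \<beta> \<gamma>)
        (\<lambda>(x, y). (x * (x + 1), y\<^sup>2 + (a * x + b) * y + c * x\<^sup>2 + d * x + e)) \<or>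
     topologically_equivalent (riccati_field \<alpha> k \<beta> \<gamma>)
        (\<lambda>(x, y). (x\<^sup>2, y\<^sup>2 + (a * x + b) * y + c * x\<^sup>2 + d * x + e)) \<or>
     topologically_equivalent (riccati_field \<alpha> k \<beta> \<gamma>)
        (\<lambda>(x, y). (x, y\<^sup>2 + (a * x + b) * y + c * x\<^sup>2 + d * x + e)) \<or>
     topologically_equivalent (riccati_field \<alpha> k \<beta> \<gamma>)
        (\<lambda>(x, y). (1, y\<^sup>2 + (a * x + b) * y + c * x\<^sup>2 + d * x + e)) \<or>
     topologically_equivalent (riccati_field \<alpha> k \<beta> \<gamma>)
        (\<lambda>(x, y). (x\<^sup>2 + 1, y\<^sup>2 + (a * x + b) * y + c * x\<^sup>2 + d * x + e)))"
proof -
  define u v w where "u = coeff \<alpha> 2" and "v = coeff \<alpha> 1" and "w = coeff \<alpha> 0"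
  have \<alpha>: "poly \<alpha> x = u * x\<^sup>2 + v * x + w" for x
    using poly_degree_le_2[OF \<open>degree \<alpha> \<le> 2\<close>] by (simp add: u_def v_def w_def)
  \<comment> \<open>What remains in each case is to find nonzero \<open>p\<close>, \<open>s\<close>
    and a shift \<open>q\<close> that bring \<open>\<alpha>\<close> to the desired shape.\<close>
  note nf = riccati_field_equivalent_normal_form[OF _ _ assms(2,3,4,6), where \<alpha> = \<alpha>]
  show ?thesis
  proof (cases "u = 0")
    case False
    then show ?thesis
    proof (cases rule: real_quadratic_cases[of u v w])
      case (distinct m n)
      \<comment> \<open>The substitution \<open>l * x + m\<close> moves the roots \<open>m\<close>
        and \<open>n\<close> to 0 and -1, and yields
        \<open>u * l\<^sup>2 * x * (x + 1)\<close>.\<close>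
      define l where "l = m - n"
      have l: "l \<noteq> 0" "n = m - l" using distinct(1) by (auto simp: l_def)
      have "x * (x + 1) = (1 / (u * l)) / l * poly \<alpha> (l * x + m)" for x
        unfolding \<alpha> distinct(2) unfolding l(2) using l(1) False
        by (simp add: field_simps)
      from nf[OF _ _ this] show ?thesis using l(1) False by simp blast
    next
      case (double m)
      \<comment> \<open>A shift puts the double root at 0; time absorbs \<open>u\<close>.\<close>
      have "x\<^sup>2 = (1 / u) / 1 * poly \<alpha> (1 * x + m)" for x
        unfolding \<alpha> double using False by simp
      from nf[OF _ _ this] show ?thesis using False by simp blast
    next
      case (complex m n)
      \<comment> \<open>The complex roots, with real part \<open>m\<close> and imaginary parts
        \<open>n\<close> and \<open>- n\<close>, are moved to the imaginary units.\<close>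
      have "x\<^sup>2 + 1 = (1 / (u * n)) / n * poly \<alpha> (n * x + m)" for x
        unfolding \<alpha> complex(2) using complex(1) False
        by (simp add: field_simps power2_eq_square)
      from nf[OF _ _ this] show ?thesis using complex(1) False by simp blast
    qed
  next
    case True
    show ?thesis
    proof (cases "v = 0")
      case False
      \<comment> \<open>The single root \<open>- w / v\<close> is shifted to 0.\<close>
      have "x = (1 / v) / 1 * poly \<alpha> (1 * x + (- w / v))" for x
        unfolding \<alpha> using True False by (simp add: field_simps)
      from nf[OF _ _ this] show ?thesis using False by simp blast
    next
      case v: True
      \<comment> \<open>Here \<open>\<alpha>\<close> is the constant \<open>w\<close>, and
        \<open>\<alpha> \<noteq> 0\<close> allows time to be rescaled to unit speed.\<close>
      have "w \<noteq> 0"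
        using \<open>\<alpha> \<noteq> 0\<close> \<alpha> True v by (auto simp flip: poly_all_0_iff_0)
      then have "1 = (1 / w) / 1 * poly \<alpha> (1 * x + 0)" for x
        unfolding \<alpha> using True v by simp
      from nf[OF _ _ this] show ?thesis using \<open>w \<noteq> 0\<close> by simp blast
    qed
  qed
qed

end
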